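(* Let $f:B(0,r)\to\mathbb{R}$ satisfy Assumption A (stated in the context). Then there exist a constant $C_0>0$ and an integer $\lambda_0\in\mathbb{N}$ such that for all integers $\lambda\ge\lambda_0$, $$\mathbb{E}_{X_1,\dots,X_\lambda\sim U(B(0,r))}\left[f(X_{(1)})\right]\le C_0\,\lambda^{-\frac2d}.$$
   Context: Here $d\ge1$ is an integer, $r>0$, $\|\cdot\|$ is the Euclidean norm on $\mathbb{R}^d$, $B(0,r)$ is the closed Euclidean ball of radius $r$ centered at $0$, and $U(S)$ is the uniform distribution on $S$. Assumption A: $f:B(0,r)\to\mathbb{R}$ is continuous and admits a unique optimum point (global minimizer) $x^\star$, with $\|x^\star\|<r$ and $f(x^\star)=0$. Moreover there are a symmetric positive definite matrix $\mathbf{H}$, a real number $\alpha>2$ and a bounded function $\varepsilon$ (there is $M>0$ with $|\varepsilon|\le M$ everywhere) such that for all $x\in B(0,r)$, $$f(x)=\|x-x^\star\|_{\mathbf{H}}^2+\|x-x^\star\|_{\mathbf{H}}^{\alpha}\,\varepsilon(x-x^\star),\qquad \|y\|_{\mathbf{H}}:=\sqrt{y^T\mathbf{H}y}.$$ Sampling: $X_1,\dots,X_\lambda$ are i.i.d. with law $U(B(0,r))$; $X_{(1)},\dots,X_{(\lambda)}$ denote the same points reordered so that $f(X_{(1)})\le\dots\le f(X_{(\lambda)})$; in particular $f(X_{(1)})=\min_{i\le\lambda}f(X_i)$. *)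

theory Defs
  imports "HOL-Probability.Probability"
begin

definition sym_pos_def :: "real ^ 'n ^ 'n \<Rightarrow> bool" where
  "sym_pos_def H \<longleftrightarrow> transpose H = H \<and> (\<forall>y. y \<noteq> 0 \<longrightarrow> 0 < y \<bullet> (H *v y))"

definition mat_norm :: "real ^ 'n ^ 'n \<Rightarrow> real ^ 'n \<Rightarrow> real" where
  "mat_norm H y = sqrt (y \<bullet> (H *v y))"

text \<open>Only the values of \<open>f\<close> on \<open>cball 0 r\<close> matter. In the expansion, \<open>0 powr \<alpha> = 0\<close> is the
  intended value at the minimizer, as \<open>\<alpha> > 2\<close>.\<close>

definition assumption_A :: "real \<Rightarrow> (real ^ 'n \<Rightarrow> real) \<Rightarrow> bool" where
  "assumption_A r f \<longleftrightarrow>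
     continuous_on (cball 0 r) f \<and>
     (\<exists>xstar.
        (\<forall>x. is_arg_min f (\<lambda>y. y \<in> cball 0 r) x \<longleftrightarrow> x = xstar) \<and>
        norm xstar < r \<and> f xstar = 0 \<and>
        (\<exists>H \<alpha> \<epsilon> M.
           sym_pos_def H \<and> \<alpha> > 2 \<and> M > 0 \<and> (\<forall>y. \<bar>\<epsilon> y\<bar> \<le> M) \<and>
           (\<forall>x\<in>cball 0 r.
              f x = (mat_norm H (x - xstar))\<^sup>2 + mat_norm H (x - xstar) powr \<alpha> * \<epsilon> (x - xstar))))"

text \<open>The underlying space is \<open>S\<close> itself rather than the ambient space, so that a function that is
  continuous on \<open>S\<close> is a random variable whatever its values outside \<open>S\<close>.\<close>

definition unif :: "'a :: euclidean_space set \<Rightarrow> 'a measure" where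
  "unif S = uniform_measure (restrict_space lborel S) S"

text \<open>The law of an i.i.d. sample \<open>X 1, \<dots>, X l\<close>.\<close>

definition iid_unif :: "nat \<Rightarrow> 'a :: euclidean_space set \<Rightarrow> (nat \<Rightarrow> 'a) measure" where
  "iid_unif l S = (\<Pi>\<^sub>M i\<in>{1..l}. unif S)"

text \<open>\<open>reordered f l X k\<close> is \<open>X\<^sub>(\<^sub>k\<^sub>)\<close>, for \<open>1 \<le> k \<le> l\<close>. Since \<^const>\<open>sort_key\<close> is stable,
  ties are broken by the index; this does not affect the values of \<open>f\<close> along the reordering.\<close>

definition reordered :: "('a \<Rightarrow> real) \<Rightarrow> nat \<Rightarrow> (nat \<Rightarrow> 'a) \<Rightarrow> nat \<Rightarrow> 'a" where
  "reordered f l X k = sort_key f (map X [1..<Suc l]) ! (k - 1)"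

lemma f_reordered_1:
  assumes "l \<ge> 1"
  shows "f (reordered f l X 1) = Min ((\<lambda>i. f (X i)) ` {1..l})"
proof -
  let ?ys = "sort_key f (map X [1..<Suc l])"
  have len: "length ?ys = l" by simp
  have set: "set ?ys = X ` {1..l}" by (auto simp: atLeastLessThanSuc_atLeastAtMost)
  have srt: "sorted (map f ?ys)" by simp
  have "Min (f ` set ?ys) = f (?ys ! 0)"
  proof (rule Min_eqI)
    fix y assume "y \<in> f ` set ?ys"
    then obtain i where i: "i < length ?ys" "y = f (?ys ! i)"
      by (metis imageE in_set_conv_nth)
    have "map f ?ys ! 0 \<le> map f ?ys ! i"
      using srt i(1) by (intro sorted_nth_mono) (simp_all del: map_map)
    then show "f (?ys ! 0) \<le> y"
      using i len assms by (metis (no_types, lifting) length_map less_le_trans nth_map zero_less_one)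
  next
    show "f (?ys ! 0) \<in> f ` set ?ys"
      using len assms by (intro imageI nth_mem) linarith
  qed simp
  then show ?thesis
    unfolding reordered_def set by (simp add: image_image)
qed

lemma space_unif [simp]: "space (unif S) = S"
  by (simp add: unif_def space_restrict_space)

lemma prob_space_unif_cball:
  assumes "r > 0"
  shows "prob_space (unif (cball (0 :: 'a :: euclidean_space) r))"
proof -
  let ?S = "cball (0 :: 'a) r"
  have eq: "emeasure (restrict_space lborel ?S) ?S = emeasure lborel ?S"
    by (intro emeasure_restrict_space) auto
  have "emeasure lborel (ball (0 :: 'a) r) \<le> emeasure lborel ?S"
    by (intro emeasure_mono) auto
  moreover have "emeasure lborel (ball (0 :: 'a) r) > 0"
    using assms by (simp add: emeasure_ball unit_ball_vol_pos)
  moreover have "emeasure lborel ?S < \<infinity>"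
    by (intro emeasure_bounded_finite) auto
  ultimately show ?thesis
    unfolding unif_def by (intro prob_space_uniform_measure) (auto simp: eq)
qed

lemma prob_space_iid_unif_cball:
  assumes "r > 0"
  shows "prob_space (iid_unif l (cball (0 :: 'a :: euclidean_space) r))"
  unfolding iid_unif_def by (intro prob_space_PiM prob_space_unif_cball assms)

end

theory Submission
  imports Defs
begin

text \<open>The expansion gives \<open>f x \<le> K * (norm (x - xstar))\<^sup>2\<close> on the ball. A sample point falls within
  distance \<open>t\<close> of \<open>xstar\<close> with probability at least \<open>c * t ^ d\<close>, so all \<open>l\<close> of them miss that
  neighbourhood with probability at most \<open>exp (- l * c * t ^ d)\<close>. At the scale
  \<open>s = l powr (- 1 / d)\<close> the squared distance to the nearest sample point is at most
  \<open>s\<^sup>2 * (\<Sum>k. (2 * k + 1) * [all points are farther than k * s])\<close>, whose expectation is at most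
  \<open>s\<^sup>2\<close> times the convergent series \<open>\<Sum>k. (2 * k + 1) * exp (- c * k)\<close>.\<close>

section \<open>Two facts on sums weighted by odd numbers\<close>

lemma sum_odd_eq_square: "(\<Sum>k<n. 2 * real k + 1) = (real n)\<^sup>2"
  by (induction n) (auto simp: power2_eq_square algebra_simps)

lemma summable_odd_mult_exp:
  assumes "c > (0::real)"
  shows "summable (\<lambda>k. (2 * real k + 1) * exp (- c * real k))"
proof -
  have eq: "exp (- c * real k) = exp (-c) ^ k" for k
    by (simp add: exp_of_nat_mult[symmetric] mult.commute)
  have lt: "norm (exp (-c)) < 1"
    using assms by simp
  have "summable (\<lambda>k. diffs (\<lambda>_. 1) k * exp (-c) ^ k)"
  proof (rule termdiff_converges)
    show "norm (exp (-c)) < 1" by (fact lt)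
    show "summable (\<lambda>n. 1 * x ^ n)" if "norm x < 1" for x :: real
      using that by (simp add: summable_geometric)
  qed
  \<comment> \<open>\<open>diffs (\<lambda>_. 1) k\<close> is k + 1, a coefficient of the derivative
    of the geometric series, and 2 * (k + 1) - 1 = 2 * k + 1.\<close>
  then have "summable (\<lambda>k. 2 * (diffs (\<lambda>_. 1) k * exp (-c) ^ k) - exp (-c) ^ k)"
    using lt by (intro summable_diff summable_mult summable_geometric)
  then show ?thesis
    unfolding eq diffs_def by (simp add: algebra_simps)
qed

section \<open>Quadratic growth of the objective\<close>

lemma mat_norm_le:
  fixes H :: "real ^ 'n ^ 'n"
  obtains c where "c > 0" "\<And>y. mat_norm H y \<le> c * norm y"
proof -
  obtain K where K: "K > 0" "\<And>y. norm (H *v y) \<le> norm y * K"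
    using bounded_linear.pos_bounded[OF matrix_vector_mul_bounded_linear[of H]] by auto
  have "mat_norm H y \<le> sqrt K * norm y" for y
  proof -
    have "y \<bullet> (H *v y) \<le> norm y * norm (H *v y)"
      by (rule norm_cauchy_schwarz)
    also have "\<dots> \<le> norm y * (norm y * K)"
      by (intro mult_left_mono K) simp
    also have "\<dots> = K * (norm y)\<^sup>2"
      by (simp add: power2_eq_square)
    finally have "mat_norm H y \<le> sqrt (K * (norm y)\<^sup>2)"
      unfolding mat_norm_def by (rule real_sqrt_le_mono)
    then show ?thesis
      by (simp add: real_sqrt_mult)
  qed
  with K(1) show ?thesis
    by (intro that[of "sqrt K"]) auto
qed

text \<open>On a bounded domain the remainder is absorbed into the quadratic term: q powr \<alpha>
  equals q^2 times q powr (\<alpha> - 2), and the last factor is bounded because \<alpha> >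
  2.\<close>

lemma assumption_A_quadratic_bound:
  fixes f :: "real ^ 'n \<Rightarrow> real"
  assumes r: "r > 0" and A: "assumption_A r f"
  obtains xstar K where "norm xstar < r" "K > 0"
    "\<And>x. x \<in> cball 0 r \<Longrightarrow> f x \<le> K * (norm (x - xstar))\<^sup>2"
proof -
  obtain xstar H \<alpha> \<epsilon> M where xstar: "norm xstar < r"
    and H: "sym_pos_def H" and \<alpha>: "\<alpha> > 2" and M: "M > 0" "\<And>y. \<bar>\<epsilon> y\<bar> \<le> M"
    and f: "\<And>x. x \<in> cball 0 r \<Longrightarrow>
      f x = (mat_norm H (x - xstar))\<^sup>2 + mat_norm H (x - xstar) powr \<alpha> * \<epsilon> (x - xstar)"
    using A unfolding assumption_A_def by blast
  obtain c where c: "c > 0" "\<And>y. mat_norm H y \<le> c * norm y"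
    using mat_norm_le[of H] by blast
  \<comment> \<open>The ball has diameter 2 * r, so \<open>c * (2 * r)\<close> bounds the H-norm of
    \<open>x - xstar\<close> throughout it.\<close>
  define K where "K = (1 + M * (c * (2 * r)) powr (\<alpha> - 2)) * c\<^sup>2"
  have "1 + M * (c * (2 * r)) powr (\<alpha> - 2) > 0"
    using M(1) by (simp add: add_pos_nonneg)
  then have "K > 0"
    unfolding K_def using c(1) by simp
  moreover have "f x \<le> K * (norm (x - xstar))\<^sup>2" if x: "x \<in> cball 0 r" for x
  proof -
    define q where "q = mat_norm H (x - xstar)"
    \<comment> \<open>\<open>sqrt\<close> is negative at negative arguments, so the sign of the
      quadratic form matters; positive definiteness speaks of nonzero vectors, hence the case
      split.\<close>
    have q0: "q \<ge> 0"
      using H unfolding q_def mat_norm_def sym_pos_def_def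
      by (cases "x - xstar = 0") (auto simp: less_imp_le)
    have qc: "q \<le> c * norm (x - xstar)"
      unfolding q_def by (rule c)
    have "norm (x - xstar) \<le> 2 * r"
      using norm_triangle_ineq4[of x xstar] x xstar by simp
    then have qr: "q \<le> c * (2 * r)"
      using qc c(1) by (meson mult_left_mono less_imp_le order_trans)
    have "f x = q\<^sup>2 + q powr \<alpha> * \<epsilon> (x - xstar)"
      unfolding q_def by (rule f[OF x])
    also have "\<dots> \<le> q\<^sup>2 + q powr \<alpha> * M"
      using M(2)[of "x - xstar"] by (intro add_left_mono mult_left_mono) auto
    also have "q powr \<alpha> = q\<^sup>2 * q powr (\<alpha> - 2)"
      using q0 \<alpha> by (cases "q = 0") (auto simp: powr_diff)
    also have "q\<^sup>2 + q\<^sup>2 * q powr (\<alpha> - 2) * M = (1 + M * q powr (\<alpha> - 2)) * q\<^sup>2"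
      by (simp add: algebra_simps)
    also have "\<dots> \<le> (1 + M * (c * (2 * r)) powr (\<alpha> - 2)) * (c * norm (x - xstar))\<^sup>2"
      using q0 qc qr \<alpha> M(1)
      by (intro mult_mono add_left_mono mult_left_mono powr_mono2 power_mono add_nonneg_nonneg) auto
    also have "\<dots> = K * (norm (x - xstar))\<^sup>2"
      unfolding K_def by (simp add: power_mult_distrib)
    finally show ?thesis .
  qed
  ultimately show ?thesis
    using xstar that by blast
qed

section \<open>Probability that the sample misses a neighbourhood of the minimizer\<close>

lemma measure_unif:
  fixes S :: "'a :: euclidean_space set"
  assumes "S \<in> sets borel" "emeasure lborel S \<noteq> 0" "emeasure lborel S \<noteq> \<infinity>"
    and "B \<in> sets borel" "B \<subseteq> S"
  shows "measure (unif S) B = measure lborel B / measure lborel S"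
proof -
  have eq: "emeasure (restrict_space lborel S) T = emeasure lborel T" if "T \<subseteq> S" for T
    using assms that by (intro emeasure_restrict_space) auto
  have "B \<in> sets (restrict_space lborel S)" "S \<in> sets (restrict_space lborel S)"
    using assms by (auto simp: sets_restrict_space_iff)
  then have "measure (unif S) B =
      measure (restrict_space lborel S) (S \<inter> B) / measure (restrict_space lborel S) S"
    unfolding unif_def using assms by (intro measure_uniform_measure) (auto simp: eq)
  also have "S \<inter> B = B"
    using assms by blast
  finally show ?thesis
    using assms by (simp add: measure_def eq)
qed

text \<open>The ball of radius t about \<open>xstar\<close> may leave the domain, so it is replaced
  by a concentric ball of radius \<open>u\<close>, proportional to t. The factor \<delta> / (2 * r)
  gives u \<le> t since \<delta> \<le> 2 * r, and u \<le> \<delta> since t \<le> 2 * r, so the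
  smaller ball lies in the domain and has probability exactly (u / r)^d. The exponential comes from
  1 - p \<le> exp (- p).\<close>

lemma measure_unif_cball_far_le:
  fixes xstar :: "'a :: euclidean_space"
  assumes xstar: "norm xstar < r" and t: "0 \<le> t" "t \<le> 2 * r"
  shows "measure (unif (cball 0 r)) {x \<in> cball 0 r. t < norm (x - xstar)}
           \<le> exp (- (((r - norm xstar) / (2 * r\<^sup>2)) ^ DIM('a) * t ^ DIM('a)))"
proof -
  let ?S = "cball (0::'a) r"
  define \<delta> where "\<delta> = r - norm xstar"
  define u where "u = t * \<delta> / (2 * r)"
  have r: "r > 0"
    using xstar norm_ge_zero[of xstar] by linarith
  have \<delta>: "\<delta> > 0" "\<delta> \<le> r"
    using xstar by (auto simp: \<delta>_def)
  have u0: "0 \<le> u"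
    unfolding u_def using t \<delta> r by simp
  have ut: "u \<le> t"
  proof -
    have "t * \<delta> \<le> t * (2 * r)"
      using t(1) \<delta> r by (intro mult_left_mono) auto
    then show ?thesis
      unfolding u_def using r by (simp add: field_simps)
  qed
  have u\<delta>: "u \<le> \<delta>"
    unfolding u_def using t \<delta> r by (simp add: field_simps)
  interpret prob_space "unif ?S"
    by (rule prob_space_unif_cball) (fact r)
  let ?N = "cball xstar u"
  have sub: "?N \<subseteq> ?S"
    using u\<delta> unfolding \<delta>_def by (simp add: cball_subset_cball_iff dist_norm)
  have sets: "B \<in> events" if "B \<in> sets borel" "B \<subseteq> ?S" for B
    using that unfolding unif_def by (simp add: sets_restrict_space_iff)
  have vol: "unit_ball_vol (real DIM('a)) \<noteq> 0"
    using unit_ball_vol_pos[of "real DIM('a)"] by linarith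
  have fin: "emeasure lborel ?S \<noteq> 0" "emeasure lborel ?S \<noteq> \<infinity>"
    using r vol by (auto simp: emeasure_cball)
  have "prob ?N = measure lborel ?N / measure lborel ?S"
    using fin sub by (intro measure_unif) auto
  also have "\<dots> = u ^ DIM('a) / r ^ DIM('a)"
    using u0 r vol by (simp add: content_cball)
  also have "\<dots> = (\<delta> / (2 * r\<^sup>2)) ^ DIM('a) * t ^ DIM('a)"
    unfolding u_def
    by (simp add: power_divide[symmetric] power_mult_distrib[symmetric] power2_eq_square mult_ac)
  finally have p: "prob ?N = (\<delta> / (2 * r\<^sup>2)) ^ DIM('a) * t ^ DIM('a)" .
  have "prob {x \<in> ?S. t < norm (x - xstar)} \<le> prob (space (unif ?S) - ?N)"
    using ut sub by (intro finite_measure_mono sets.compl_sets sets) (auto simp: dist_norm norm_minus_commute)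
  also have "\<dots> = 1 - prob ?N"
    using sub by (intro prob_compl sets) auto
  also have "\<dots> \<le> exp (- prob ?N)"
    using exp_ge_add_one_self[of "- prob ?N"] by simp
  finally show ?thesis
    unfolding p \<delta>_def .
qed

text \<open>Independence of the sample enters here: the event that all points lie in
  \<open>A\<close> is a product set.\<close>

lemma measure_iid_unif_cball_all:
  fixes A :: "'a :: euclidean_space set"
  assumes r: "r > 0" and A: "A \<in> sets (unif (cball 0 r))"
  shows "(\<Pi>\<^sub>E i\<in>{1..l}. A) \<in> sets (iid_unif l (cball 0 r))"
    and "measure (iid_unif l (cball 0 r)) (\<Pi>\<^sub>E i\<in>{1..l}. A) = measure (unif (cball 0 r)) A ^ l"
proof -
  interpret U: prob_space "unif (cball (0::'a) r)"
    by (rule prob_space_unif_cball) (fact r)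
  interpret finite_product_prob_space "\<lambda>_. unif (cball (0::'a) r)" "{1..l}"
    by unfold_locales auto
  show "(\<Pi>\<^sub>E i\<in>{1..l}. A) \<in> sets (iid_unif l (cball 0 r))"
    unfolding iid_unif_def using A by (intro sets_PiM_I_finite) auto
  show "measure (iid_unif l (cball 0 r)) (\<Pi>\<^sub>E i\<in>{1..l}. A) = measure (unif (cball 0 r)) A ^ l"
    unfolding iid_unif_def using A by (subst finite_measure_PiM_emb) auto
qed

section \<open>Pointwise majorant of the sample minimum\<close>

text \<open>Let n be least such that some sample point is within n * s of \<open>xstar\<close>. The
  events with index k < n all occur, and their weights, the first n odd numbers, add up to n^2.
  Truncating at \<open>m\<close> leaves a finite sum to integrate.\<close>

lemma min_quadratic_le_sum_indicator:
  fixes f :: "'a :: real_normed_vector \<Rightarrow> real"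
  assumes l: "l \<ge> 1" and K: "K \<ge> 0" and s: "s \<ge> 0" and rm: "2 * r \<le> real m * s"
    and xstar: "norm xstar \<le> r"
    and f: "\<And>x. x \<in> cball 0 r \<Longrightarrow> f x \<le> K * (norm (x - xstar))\<^sup>2"
    and X: "X \<in> (\<Pi>\<^sub>E i\<in>{1..l}. cball 0 r)"
  shows "f (reordered f l X 1) \<le> K * s\<^sup>2 * (\<Sum>k<m. (2 * real k + 1) *
    indicator (\<Pi>\<^sub>E i\<in>{1..l}. {x \<in> cball 0 r. real k * s < norm (x - xstar)}) X)"
proof -
  let ?E = "\<lambda>k. \<Pi>\<^sub>E i\<in>{1..l}. {x \<in> cball 0 r. real k * s < norm (x - xstar)}"
  define P where "P n \<longleftrightarrow> (\<exists>i\<in>{1..l}. norm (X i - xstar) \<le> real n * s)" for n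
  have "norm (X 1 - xstar) \<le> 2 * r"
    using norm_triangle_ineq4[of "X 1" xstar] PiE_mem[OF X, of 1] l xstar by simp
  \<comment> \<open>Every point of the domain is within 2 * r \<le> m * s of \<open>xstar\<close>,
    so n exists and is at most \<open>m\<close>; the first sample point is a witness.\<close>
  then have "P m"
    unfolding P_def using l rm by (intro bexI[of _ 1]) auto
  define n where "n = (LEAST n. P n)"
  have least: "\<not> P k" if "k < n" for k
    using that unfolding n_def by (rule not_less_Least)
  have nm: "n \<le> m" and Pn: "P n"
    using \<open>P m\<close> unfolding n_def by (auto intro: Least_le LeastI)
  obtain i where i: "i \<in> {1..l}" "norm (X i - xstar) \<le> real n * s"
    using Pn unfolding P_def by blast
  have in_E: "X \<in> ?E k" if "k < n" for k
    using least[OF that] X unfolding P_def by (auto simp: PiE_iff not_le)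
  have "f (reordered f l X 1) \<le> f (X i)"
    unfolding f_reordered_1[OF l] using i by (intro Min_le) auto
  also have "\<dots> \<le> K * (norm (X i - xstar))\<^sup>2"
    using PiE_mem[OF X i(1)] by (rule f)
  also have "\<dots> \<le> K * (real n * s)\<^sup>2"
    using i K by (intro mult_left_mono power_mono) auto
  also have "\<dots> = K * s\<^sup>2 * (\<Sum>k<n. 2 * real k + 1)"
    unfolding sum_odd_eq_square by (simp add: power_mult_distrib)
  also have "(\<Sum>k<n. 2 * real k + 1) = (\<Sum>k<n. (2 * real k + 1) * indicator (?E k) X)"
    using in_E by (intro sum.cong) auto
  also have "K * s\<^sup>2 * \<dots> \<le> K * s\<^sup>2 * (\<Sum>k<m. (2 * real k + 1) * indicator (?E k) X)"
    using K nm by (intro mult_left_mono sum_mono2) auto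
  finally show ?thesis .
qed

section \<open>Bound on the expectation\<close>

theorem lemma3:
  fixes f :: "real ^ 'n \<Rightarrow> real" and r :: real
  assumes "r > 0" and "assumption_A r f"
  shows "\<exists>C0 > 0. \<exists>l0 :: nat. \<forall>l \<ge> l0.
           (\<integral>X. f (reordered f l X 1) \<partial>(iid_unif l (cball 0 r)))
             \<le> C0 * real l powr (- 2 / real CARD('n))"
proof -
  obtain xstar K where xstar: "norm xstar < r" and K: "K > 0"
    and f: "\<And>x. x \<in> cball 0 r \<Longrightarrow> f x \<le> K * (norm (x - xstar))\<^sup>2"
    using assumption_A_quadratic_bound[OF assms] by blast
  let ?d = "CARD('n)"
  let ?S = "cball (0 :: real ^ 'n) r"
  have d: "?d \<ge> 1" by (simp add: Suc_leI)
  define c where "c = ((r - norm xstar) / (2 * r\<^sup>2)) ^ ?d"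
  have c: "c > 0"
    unfolding c_def using xstar assms(1) by simp
  define T where "T = (\<Sum>k. (2 * real k + 1) * exp (- c * real k))"
  have T: "T > 0"
    unfolding T_def by (intro suminf_pos summable_odd_mult_exp c) (simp add: add_nonneg_pos)
  have "(\<integral>X. f (reordered f l X 1) \<partial>(iid_unif l ?S)) \<le> K * T * real l powr (- 2 / real ?d)"
    if l: "l \<ge> 1" for l
  proof -
    let ?M = "iid_unif l ?S"
    \<comment> \<open>This scale makes l * s^d equal to 1, which removes l from the exponents of the
      miss probabilities.\<close>
    define s where "s = real l powr (- 1 / real ?d)"
    have s: "s > 0" using l by (simp add: s_def)
    have s2: "s\<^sup>2 = real l powr (- 2 / real ?d)"
      unfolding s_def using l by (simp add: powr_power)
    have sd: "real l * s ^ ?d = 1"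
    proof -
      have "s ^ ?d = real l powr (- 1)"
        unfolding s_def using l by (subst powr_power) auto
      then show ?thesis
        using l by (simp add: powr_minus)
    qed
    \<comment> \<open>The ceiling serves twice: m * s \<ge> 2 * r, as the pointwise majorant
      requires, and k < m still gives k * s \<le> 2 * r, the range of the tail estimate.\<close>
    define m where "m = nat \<lceil>2 * r / s\<rceil>"
    have "2 * r / s \<le> real m"
      unfolding m_def by (rule real_nat_ceiling_ge)
    then have rm: "2 * r \<le> real m * s"
      using s by (simp add: field_simps)
    define A where "A k = {x \<in> ?S. real k * s < norm (x - xstar)}" for k :: nat
    let ?E = "\<lambda>k. \<Pi>\<^sub>E i\<in>{1..l}. A k"
    interpret prob_space ?M
      by (rule prob_space_iid_unif_cball) (fact assms(1))
    have "A k \<in> sets (unif ?S)" for k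
    proof -
      have "A k = ?S \<inter> {x. real k * s < norm (x - xstar)}"
        unfolding A_def by auto
      then have "A k \<in> sets borel" by simp
      then show ?thesis
        unfolding unif_def by (auto simp: sets_restrict_space_iff A_def)
    qed
    note E = measure_iid_unif_cball_all[OF assms(1) this, of l]
    have prob_E: "prob (?E k) \<le> exp (- c * real k)" if "k < m" for k
    proof -
      have "real k < 2 * r / s"
        using that unfolding m_def by linarith
      then have "real k * s \<le> 2 * r"
        using s by (simp add: field_simps)
      then have "measure (unif ?S) (A k) \<le> exp (- (c * (real k * s) ^ ?d))"
        unfolding A_def c_def using measure_unif_cball_far_le[OF xstar, of "real k * s"] s by simp
      then have "prob (?E k) \<le> exp (- (c * (real k * s) ^ ?d)) ^ l"
        unfolding E by (intro power_mono) auto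
      also have "\<dots> = exp (- (c * real k ^ ?d * (real l * s ^ ?d)))"
        by (simp add: exp_of_nat_mult[symmetric] power_mult_distrib algebra_simps)
      also have "\<dots> = exp (- (c * real (k ^ ?d)))"
        unfolding sd by simp
      \<comment> \<open>Lowering k^d to k leaves one series that serves every dimension.\<close>
      also have "\<dots> \<le> exp (- c * real k)"
      proof -
        have "k \<le> k ^ ?d"
          using d by (cases "k = 0") (auto intro: self_le_power)
        then show ?thesis
          using c by (simp add: of_nat_le_iff del: of_nat_power)
      qed
      finally show ?thesis .
    qed
    have int: "integrable ?M (\<lambda>X. (2 * real k + 1) * indicator (?E k) X)" for k
      using E by (intro integrable_mult_right integrable_real_indicator) (auto simp: emeasure_eq_measure)
    have "(\<integral>X. f (reordered f l X 1) \<partial>?M)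
        \<le> (\<integral>X. K * s\<^sup>2 * (\<Sum>k<m. (2 * real k + 1) * indicator (?E k) X) \<partial>?M)"
    \<comment> \<open>Integrability and nonnegativity are required of the majorant alone: were the
      minimum not integrable, its Bochner integral would be 0 by convention.\<close>
    proof (rule integral_mono')
      show "integrable ?M (\<lambda>X. K * s\<^sup>2 * (\<Sum>k<m. (2 * real k + 1) * indicator (?E k) X))"
        by (intro integrable_mult_right Bochner_Integration.integrable_sum int)
      fix X assume "X \<in> space ?M"
      then have X: "X \<in> (\<Pi>\<^sub>E i\<in>{1..l}. ?S)"
        by (simp add: iid_unif_def space_PiM)
      show "f (reordered f l X 1) \<le> K * s\<^sup>2 * (\<Sum>k<m. (2 * real k + 1) * indicator (?E k) X)"
        unfolding A_def
        using l K s rm xstar f X by (intro min_quadratic_le_sum_indicator) auto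
      show "0 \<le> K * s\<^sup>2 * (\<Sum>k<m. (2 * real k + 1) * indicator (?E k) X)"
        using K by (intro mult_nonneg_nonneg sum_nonneg) auto
    qed
    also have "\<dots> = K * s\<^sup>2 * (\<Sum>k<m. (2 * real k + 1) * prob (?E k))"
      using E(1) by (simp only: integral_mult_right_zero Bochner_Integration.integral_sum[OF int]
          Bochner_Integration.integral_indicator sets.Int_space_eq2)
    also have "\<dots> \<le> K * s\<^sup>2 * (\<Sum>k<m. (2 * real k + 1) * exp (- c * real k))"
      using K prob_E by (intro mult_left_mono sum_mono) auto
    \<comment> \<open>\<open>m\<close> grows with l, so the partial sum is replaced by the full
      series \<open>T\<close>, which is independent of l.\<close>
    also have "\<dots> \<le> K * s\<^sup>2 * T"
      unfolding T_def using K
      by (intro mult_left_mono sum_le_suminf summable_odd_mult_exp c) auto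
    finally show ?thesis
      unfolding s2 by (simp add: mult_ac)
  qed
  with K T show ?thesis
    by (intro exI[of _ "K * T"] conjI exI[of _ 1]) auto
qed

end
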